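(* For $i=1,2$ consider two systems of energy-based form $$\begin{bmatrix}\nabla_{z_1^{[i]}}\mathcal H^{[i]}(z_1^{[i]},z_2^{[i]})\\ \mathcal E^{[i]}\frac{\mathrm d}{\mathrm dt}z_2^{[i]}\\ 0\end{bmatrix}=(\mathcal J^{[i]}-\mathcal R^{[i]})\begin{bmatrix}\frac{\mathrm d}{\mathrm dt}z_1^{[i]}\\ e^{[i]}(z_1^{[i]},z_2^{[i]})\\ z_3^{[i]}\end{bmatrix}+\mathcal B^{[i]}u^{[i]},\qquad y^{[i]}=(\mathcal B^{[i]})^\top\begin{bmatrix}\frac{\mathrm d}{\mathrm dt}z_1^{[i]}\\ e^{[i]}(z_1^{[i]},z_2^{[i]})\\ z_3^{[i]}\end{bmatrix},$$ with respective states $z^{[i]}=(z_1^{[i]},z_2^{[i]},z_3^{[i]})$, energy functions $\mathcal H^{[i]}$ and efforts $e^{[i]}$. Let $\mathcal F_{\mathrm{skew}}=-\mathcal F_{\mathrm{skew}}^\top$ and let $\mathcal F_{\mathrm{sym}}=\mathcal F_{\mathrm{sym}}^\top$ be positive semi-definite, both real square matrices of size equal to the total number of inputs of the two systems. Then the interconnection $$\begin{bmatrix} u^{[1]} \\ {u}^{[2]} \end{bmatrix}=(\mathcal F_{\mathrm{skew}}-\mathcal F_{\mathrm{sym}})\begin{bmatrix} y^{[1]} \\ {y}^{[2]} \end{bmatrix}+\begin{bmatrix} \tilde u^{[1]} \\ {\tilde u}^{[2]} \end{bmatrix}$$ yields again a system of energy-based form, in the combined state $(z^{[1]},z^{[2]})$,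 with input $(\tilde u^{[1]},\tilde u^{[2]})$ and output $(y^{[1]},y^{[2]})$.
   Context: A system of energy-based form with state $z=(z_1,z_2,z_3)\in C^1([t_0,t_{\mathrm f}],\mathbb R^{n_1}\times\mathbb R^{n_2}\times\mathbb R^{n_3})$, input $u\colon[t_0,t_{\mathrm f}]\to\mathbb R^m$ and output $y\in C([t_0,t_{\mathrm f}],\mathbb R^m)$ is a system of equations $$\begin{bmatrix}\nabla_{z_1}\mathcal H(z_1,z_2)\\ \mathcal E\frac{\mathrm d}{\mathrm dt}z_2\\ 0\end{bmatrix}=(\mathcal J-\mathcal R)\begin{bmatrix}\frac{\mathrm d}{\mathrm dt}z_1\\ e(z_1,z_2)\\ z_3\end{bmatrix}+\mathcal B u,\qquad y=\mathcal B^\top\begin{bmatrix}\frac{\mathrm d}{\mathrm dt}z_1\\ e(z_1,z_2)\\ z_3\end{bmatrix},$$ where $\mathcal H\in C^1(\mathbb R^{n_1}\times\mathbb R^{n_2})$, $e\in C(\mathbb R^{n_1}\times\mathbb R^{n_2},\mathbb R^{n_2})$, $\mathcal E\in\mathbb R^{n_2\times n_2}$ (possibly singular), $\mathcal J,\mathcal R\in\mathbb R^{n\times n}$, $\mathcal B\in\mathbb R^{n\times m}$ with $n=n_1+n_2+n_3$, such that $\mathcal J=-\mathcal J^\top$, $\mathcal R=\mathcal R^\top$ is positive semi-definite, and $\mathcal E^\top e(z_1,z_2)=\nabla_{z_2}\mathcal H(z_1,z_2)$ for all $(z_1,z_2)$. The combined state is grouped into the three components by stacking, i.e. its $k$-th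 component is $(z_k^{[1]},z_k^{[2]})$, $k=1,2,3$. *)

theory Defs
  imports
    "HOL-Analysis.Derivative"
    "HOL-Analysis.Function_Topology"
    "Jordan_Normal_Form.Matrix"
begin

(* The dimensions are natural numbers and may be 0 (e.g. no algebraic variables), so R^n is
   carrier_vec n and not a type indexed by a (nonempty) finite type. *)

record eb_system =
  dim_z1 :: nat
  dim_z2 :: nat
  dim_z3 :: nat
  dim_io :: nat
  energy :: "real vec \<Rightarrow> real vec \<Rightarrow> real"
  effort :: "real vec \<Rightarrow> real vec \<Rightarrow> real vec"
  mat_E :: "real mat"
  mat_J :: "real mat"
  mat_R :: "real mat"
  mat_B :: "real mat"

abbreviation dim_total :: "eb_system \<Rightarrow> nat" where
  "dim_total S \<equiv> dim_z1 S + dim_z2 S + dim_z3 S"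

definition pos_semidef :: "nat \<Rightarrow> real mat \<Rightarrow> bool" where
  "pos_semidef n A \<longleftrightarrow> (\<forall>x\<in>carrier_vec n. 0 \<le> scalar_prod x (A *\<^sub>v x))"

(* The library type of vectors carries no topology.  The map (f 0, f 1, ...) to (f 0, ..., f (n-1))
   from nat => real (product topology) onto R^n is an open continuous surjection, so a function on
   R^n1 x R^n2 is continuous iff its composition with these maps is. *)
definition continuous_on_pairs :: "nat \<Rightarrow> nat \<Rightarrow> (real vec \<Rightarrow> real vec \<Rightarrow> real) \<Rightarrow> bool" where
  "continuous_on_pairs n1 n2 f \<longleftrightarrow>
     continuous_on UNIV (\<lambda>(p :: nat \<Rightarrow> real, q :: nat \<Rightarrow> real). f (vec n1 p) (vec n2 q))"

definition grad1 :: "nat \<Rightarrow> (real vec \<Rightarrow> real vec \<Rightarrow> real) \<Rightarrow> real vec \<Rightarrow> real vec \<Rightarrow> real vec" where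
  "grad1 n H x y = vec n (\<lambda>i. deriv (\<lambda>s. H (x + s \<cdot>\<^sub>v unit_vec n i) y) 0)"

definition grad2 :: "nat \<Rightarrow> (real vec \<Rightarrow> real vec \<Rightarrow> real) \<Rightarrow> real vec \<Rightarrow> real vec \<Rightarrow> real vec" where
  "grad2 n H x y = vec n (\<lambda>i. deriv (\<lambda>s. H x (y + s \<cdot>\<^sub>v unit_vec n i)) 0)"

(* C^1 on R^n1 x R^n2: all first-order partial derivatives exist and are continuous. *)
definition C1_on_pairs :: "nat \<Rightarrow> nat \<Rightarrow> (real vec \<Rightarrow> real vec \<Rightarrow> real) \<Rightarrow> bool" where
  "C1_on_pairs n1 n2 H \<longleftrightarrow>
     (\<forall>i<n1. (\<forall>x\<in>carrier_vec n1. \<forall>y\<in>carrier_vec n2.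
                (\<lambda>s. H (x + s \<cdot>\<^sub>v unit_vec n1 i) y) field_differentiable at 0)
           \<and> continuous_on_pairs n1 n2 (\<lambda>x y. vec_index (grad1 n1 H x y) i)) \<and>
     (\<forall>i<n2. (\<forall>x\<in>carrier_vec n1. \<forall>y\<in>carrier_vec n2.
                (\<lambda>s. H x (y + s \<cdot>\<^sub>v unit_vec n2 i)) field_differentiable at 0)
           \<and> continuous_on_pairs n1 n2 (\<lambda>x y. vec_index (grad2 n2 H x y) i))"

definition energy_based_form :: "eb_system \<Rightarrow> bool" where
  "energy_based_form S \<longleftrightarrow>
     C1_on_pairs (dim_z1 S) (dim_z2 S) (energy S) \<and>
     (\<forall>x\<in>carrier_vec (dim_z1 S). \<forall>y\<in>carrier_vec (dim_z2 S).
        effort S x y \<in> carrier_vec (dim_z2 S)) \<and>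
     (\<forall>i<dim_z2 S. continuous_on_pairs (dim_z1 S) (dim_z2 S) (\<lambda>x y. vec_index (effort S x y) i)) \<and>
     mat_E S \<in> carrier_mat (dim_z2 S) (dim_z2 S) \<and>
     mat_J S \<in> carrier_mat (dim_total S) (dim_total S) \<and>
     mat_R S \<in> carrier_mat (dim_total S) (dim_total S) \<and>
     mat_B S \<in> carrier_mat (dim_total S) (dim_io S) \<and>
     mat_J S = - transpose_mat (mat_J S) \<and>
     mat_R S = transpose_mat (mat_R S) \<and>
     pos_semidef (dim_total S) (mat_R S) \<and>
     (\<forall>x\<in>carrier_vec (dim_z1 S). \<forall>y\<in>carrier_vec (dim_z2 S).
        transpose_mat (mat_E S) *\<^sub>v effort S x y = grad2 (dim_z2 S) (energy S) x y)"

type_synonym state = "real vec \<times> real vec \<times> real vec"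

definition states :: "eb_system \<Rightarrow> state set" where
  "states S = carrier_vec (dim_z1 S) \<times> carrier_vec (dim_z2 S) \<times> carrier_vec (dim_z3 S)"

(* The defining equations at one instant: z is the value of the state, dz that of its time
   derivative (whose third component does not occur), u the input and y the output. *)
fun eb_equations :: "eb_system \<Rightarrow> state \<Rightarrow> state \<Rightarrow> real vec \<Rightarrow> real vec \<Rightarrow> bool" where
  "eb_equations S (z1, z2, z3) (dz1, dz2, dz3) u y \<longleftrightarrow>
     grad1 (dim_z1 S) (energy S) z1 z2 @\<^sub>v (mat_E S *\<^sub>v dz2) @\<^sub>v 0\<^sub>v (dim_z3 S)
       = (mat_J S - mat_R S) *\<^sub>v (dz1 @\<^sub>v effort S z1 z2 @\<^sub>v z3) + mat_B S *\<^sub>v u \<and>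
     y = transpose_mat (mat_B S) *\<^sub>v (dz1 @\<^sub>v effort S z1 z2 @\<^sub>v z3)"

(* Derivatives are taken within the time interval T, hence one-sided at its end points. *)
definition curve_deriv :: "nat \<Rightarrow> real set \<Rightarrow> (real \<Rightarrow> real vec) \<Rightarrow> real \<Rightarrow> real vec" where
  "curve_deriv n T f t = vec n (\<lambda>i. vector_derivative (\<lambda>s. vec_index (f s) i) (at t within T))"

definition C0_curve :: "nat \<Rightarrow> real set \<Rightarrow> (real \<Rightarrow> real vec) \<Rightarrow> bool" where
  "C0_curve n T f \<longleftrightarrow> f \<in> T \<rightarrow> carrier_vec n \<and> (\<forall>i<n. continuous_on T (\<lambda>s. vec_index (f s) i))"

definition C1_curve :: "nat \<Rightarrow> real set \<Rightarrow> (real \<Rightarrow> real vec) \<Rightarrow> bool" where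
  "C1_curve n T f \<longleftrightarrow> f \<in> T \<rightarrow> carrier_vec n \<and>
     (\<forall>i<n. (\<lambda>s. vec_index (f s) i) differentiable_on T) \<and> C0_curve n T (curve_deriv n T f)"

definition state_deriv :: "eb_system \<Rightarrow> real set \<Rightarrow> (real \<Rightarrow> state) \<Rightarrow> real \<Rightarrow> state" where
  "state_deriv S T z t =
     (curve_deriv (dim_z1 S) T (\<lambda>s. fst (z s)) t,
      curve_deriv (dim_z2 S) T (\<lambda>s. fst (snd (z s))) t,
      curve_deriv (dim_z3 S) T (\<lambda>s. snd (snd (z s))) t)"

definition eb_solution ::
  "eb_system \<Rightarrow> real set \<Rightarrow> (real \<Rightarrow> state) \<Rightarrow> (real \<Rightarrow> real vec) \<Rightarrow> (real \<Rightarrow> real vec) \<Rightarrow> bool" where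
  "eb_solution S T z u y \<longleftrightarrow>
     C1_curve (dim_z1 S) T (\<lambda>s. fst (z s)) \<and>
     C1_curve (dim_z2 S) T (\<lambda>s. fst (snd (z s))) \<and>
     C1_curve (dim_z3 S) T (\<lambda>s. snd (snd (z s))) \<and>
     u \<in> T \<rightarrow> carrier_vec (dim_io S) \<and>
     C0_curve (dim_io S) T y \<and>
     (\<forall>t\<in>T. eb_equations S (z t) (state_deriv S T z t) (u t) (y t))"

fun stack :: "state \<Rightarrow> state \<Rightarrow> state" where
  "stack (a1, a2, a3) (b1, b2, b3) = (a1 @\<^sub>v b1, a2 @\<^sub>v b2, a3 @\<^sub>v b3)"

definition interconnected ::
  "real mat \<Rightarrow> real vec \<Rightarrow> real vec \<Rightarrow> real vec \<Rightarrow> real vec \<Rightarrow> real vec \<Rightarrow> real vec \<Rightarrow> bool" where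
  "interconnected F u1 u2 y1 y2 v1 v2 \<longleftrightarrow> u1 @\<^sub>v u2 = F *\<^sub>v (y1 @\<^sub>v y2) + (v1 @\<^sub>v v2)"

end

theory Submission
  imports Defs "Jordan_Normal_Form.Determinant"
begin

text \<open>Concatenating the two systems gives a system with block diagonal structure matrices and the
  separable energy \<open>H1 + H2\<close>. Since the output is \<open>y = B\<^sup>T f\<close> for the flow-effort vector \<open>f\<close>, the
  feedback \<open>u = (K - L) y + v\<close> with \<open>K\<close> skew-symmetric and \<open>L\<close> positive semi-definite
  contributes \<open>B (K - L) B\<^sup>T f\<close>, so that \<open>B K B\<^sup>T\<close> is absorbed into the
  skew-symmetric part and \<open>B L B\<^sup>T\<close> into the positive semi-definite part. The concatenation is not yet
  ordered by the three state components; this is repaired by a permutation matrix \<open>P\<close>, and the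
  structural properties survive the congruence \<open>M \<mapsto> P M P\<^sup>T\<close>.\<close>

subsection \<open>Block diagonal matrices and congruence transformations\<close>

text \<open>The zero blocks take their sizes from \<open>A\<close> and \<open>B\<close>, so the
  diagonal blocks may be rectangular, as input matrices are, or empty.\<close>

definition block_diag :: "real mat \<Rightarrow> real mat \<Rightarrow> real mat" where
  "block_diag A B = four_block_mat A (0\<^sub>m (dim_row A) (dim_col B)) (0\<^sub>m (dim_row B) (dim_col A)) B"

lemma block_diag_carrier [simp, intro]:
  "A \<in> carrier_mat k l \<Longrightarrow> B \<in> carrier_mat m n \<Longrightarrow> block_diag A B \<in> carrier_mat (k + m) (l + n)"
  by (simp add: block_diag_def)

lemma block_diag_mult_append:
  assumes "A \<in> carrier_mat k l" "B \<in> carrier_mat m n" "x \<in> carrier_vec l" "y \<in> carrier_vec n"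
  shows "block_diag A B *\<^sub>v (x @\<^sub>v y) = A *\<^sub>v x @\<^sub>v B *\<^sub>v y"
  unfolding block_diag_def using assms
  by (subst four_block_mat_mult_vec[of A k l _ n _ m]) auto

lemma block_diag_transpose: "transpose_mat (block_diag A B) = block_diag (transpose_mat A) (transpose_mat B)"
  unfolding block_diag_def by (rule eq_matI) auto

lemma block_diag_uminus: "- block_diag A B = block_diag (- A) (- B)"
  unfolding block_diag_def by (rule eq_matI) auto

lemma block_diag_minus:
  assumes "A \<in> carrier_mat k l" "A' \<in> carrier_mat k l" "B \<in> carrier_mat m n" "B' \<in> carrier_mat m n"
  shows "block_diag A B - block_diag A' B' = block_diag (A - A') (B - B')"
  unfolding block_diag_def using assms by (intro eq_matI) auto

text \<open>Transposing \<open>M A M^T\<close> only transposes the middle factor. A rectangular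
  \<open>M\<close> is allowed because the lemma serves twice: with the joint input matrix for the
  feedback, and with the permutation matrix for the reordering.\<close>

lemma skew_congruence:
  fixes A M :: "real mat"
  assumes A: "A \<in> carrier_mat n n" and M: "M \<in> carrier_mat m n" and skew: "A = - transpose_mat A"
  shows "M * A * transpose_mat M = - transpose_mat (M * A * transpose_mat M)"
proof -
  have "transpose_mat (M * A * transpose_mat M) = M * (transpose_mat A * transpose_mat M)"
    using A M by (simp add: transpose_mult[of "M * A" m n _ m] transpose_mult[of M m n A n]
        del: assoc_mult_mat)
  also have "transpose_mat A = - A"
    by (subst skew) (simp add: transpose_uminus)
  also have "M * (- A * transpose_mat M) = - (M * A * transpose_mat M)"
    using A M by (simp add: assoc_mult_mat[of _ _ n _ n])
  finally show ?thesis
    by simp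
qed

lemma sym_congruence:
  fixes A M :: "real mat"
  assumes A: "A \<in> carrier_mat n n" and M: "M \<in> carrier_mat m n" and sym: "A = transpose_mat A"
  shows "M * A * transpose_mat M = transpose_mat (M * A * transpose_mat M)"
  using A M sym[symmetric]
  by (simp add: transpose_mult[of M m n _ m] transpose_mult[of A n n _ m] assoc_mult_mat[of M m n A n _ m])

text \<open>Moving \<open>M\<close> to the other side of the scalar product turns the quadratic form
  at \<open>x\<close> into that of \<open>A\<close> at \<open>M^T x\<close>.\<close>

lemma pos_semidef_congruence:
  assumes A: "A \<in> carrier_mat n n" and M: "M \<in> carrier_mat m n" and psd: "pos_semidef n A"
  shows "pos_semidef m (M * A * transpose_mat M)"
  unfolding pos_semidef_def
proof
  fix x :: "real vec" assume x: "x \<in> carrier_vec m"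
  let ?w = "transpose_mat M *\<^sub>v x"
  have w: "?w \<in> carrier_vec n"
    using M x by simp
  have "scalar_prod x (M * A * transpose_mat M *\<^sub>v x) = scalar_prod x (M *\<^sub>v (A *\<^sub>v ?w))"
    using A M x w by (simp add: assoc_mult_mat_vec[of _ m n _ m] assoc_mult_mat_vec[of _ m n _ n] del: assoc_mult_mat)
  also have "\<dots> = scalar_prod ?w (A *\<^sub>v ?w)"
    using A M x w by (metis transpose_vec_mult_scalar mult_mat_vec_carrier transpose_carrier_mat
        transpose_transpose comm_scalar_prod)
  finally show "0 \<le> scalar_prod x (M * A * transpose_mat M *\<^sub>v x)"
    using psd w by (simp add: pos_semidef_def)
qed

lemma pos_semidef_add:
  assumes "A \<in> carrier_mat n n" "B \<in> carrier_mat n n" "pos_semidef n A" "pos_semidef n B"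
  shows "pos_semidef n (A + B)"
  using assms
  by (auto simp: pos_semidef_def add_mult_distrib_mat_vec scalar_prod_add_distrib[of _ n])

text \<open>By \<open>all_vec_append\<close> it suffices to test concatenated vectors, on which the
  quadratic form is the sum of the forms of \<open>A\<close> and \<open>B\<close>.\<close>

lemma pos_semidef_block_diag:
  assumes A: "A \<in> carrier_mat m m" "pos_semidef m A" and B: "B \<in> carrier_mat n n" "pos_semidef n B"
  shows "pos_semidef (m + n) (block_diag A B)"
  using A B unfolding pos_semidef_def all_vec_append
  by (simp add: block_diag_mult_append[OF A(1) B(1)] scalar_prod_append[of _ m _ n])

subsection \<open>Regrouping two three-part vectors componentwise\<close>

text \<open>If \<open>xk\<close> has dimension \<open>ak\<close> and \<open>yk\<close> has dimension \<open>bk\<close>, the entry \<open>i\<close> of the regrouped vector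
  \<open>(x1, y1, x2, y2, x3, y3)\<close> is the entry \<open>regroup_index a1 a2 a3 b1 b2 i\<close> of \<open>(x1, x2, x3, y1, y2, y3)\<close>.\<close>

definition regroup_index :: "nat \<Rightarrow> nat \<Rightarrow> nat \<Rightarrow> nat \<Rightarrow> nat \<Rightarrow> nat \<Rightarrow> nat" where
  "regroup_index a1 a2 a3 b1 b2 i =
     (if i < a1 then i
      else if i < a1 + b1 then i + a2 + a3
      else if i < a1 + b1 + a2 then i - b1
      else if i < a1 + b1 + a2 + b2 then i + a3
      else if i < a1 + b1 + a2 + b2 + a3 then i - (b1 + b2)
      else i)"

text \<open>A permutation matrix whose rows are unit vectors. The length \<open>b3\<close> enters
  through the size alone, since the block \<open>y3\<close> stays at the end.\<close>

definition regroup_mat :: "nat \<Rightarrow> nat \<Rightarrow> nat \<Rightarrow> nat \<Rightarrow> nat \<Rightarrow> nat \<Rightarrow> real mat" where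
  "regroup_mat a1 a2 a3 b1 b2 b3 = (let n = a1 + a2 + a3 + (b1 + b2 + b3) in
     mat n n (\<lambda>(i, j). if j = regroup_index a1 a2 a3 b1 b2 i then 1 else 0))"

lemma regroup_mat_carrier:
  "a1 + a2 + a3 + (b1 + b2 + b3) = n \<Longrightarrow> regroup_mat a1 a2 a3 b1 b2 b3 \<in> carrier_mat n n"
  by (auto simp: regroup_mat_def Let_def)

lemma regroup_index_less:
  "i < a1 + a2 + a3 + (b1 + b2 + b3) \<Longrightarrow>
     regroup_index a1 a2 a3 b1 b2 i < a1 + a2 + a3 + (b1 + b2 + b3)"
  unfolding regroup_index_def by (simp split: if_splits) linarith

text \<open>The blocks have disjoint images, and indices beyond the moved blocks are fixed, so
  injectivity holds on all natural numbers. It makes the rows of the permutation matrix pairwise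
  orthogonal.\<close>

lemma regroup_index_inj: "regroup_index a1 a2 a3 b1 b2 i = regroup_index a1 a2 a3 b1 b2 j \<Longrightarrow> i = j"
  unfolding regroup_index_def by (simp split: if_splits)

lemma regroup_mat_mult_vec_index:
  assumes "x \<in> carrier_vec (a1 + a2 + a3 + (b1 + b2 + b3))" "i < a1 + a2 + a3 + (b1 + b2 + b3)"
  shows "vec_index (regroup_mat a1 a2 a3 b1 b2 b3 *\<^sub>v x) i = vec_index x (regroup_index a1 a2 a3 b1 b2 i)"
  using assms regroup_index_less[OF assms(2)]
  by (simp add: regroup_mat_def Let_def scalar_prod_def if_distrib[of "\<lambda>c. c * _"] cong: if_cong)

lemma regroup_mat_append:
  assumes "x1 \<in> carrier_vec a1" "x2 \<in> carrier_vec a2" "x3 \<in> carrier_vec a3"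
    "y1 \<in> carrier_vec b1" "y2 \<in> carrier_vec b2" "y3 \<in> carrier_vec b3"
  shows "regroup_mat a1 a2 a3 b1 b2 b3 *\<^sub>v ((x1 @\<^sub>v x2 @\<^sub>v x3) @\<^sub>v (y1 @\<^sub>v y2 @\<^sub>v y3)) =
    (x1 @\<^sub>v y1) @\<^sub>v (x2 @\<^sub>v y2) @\<^sub>v (x3 @\<^sub>v y3)" (is "_ *\<^sub>v ?x = ?y")
proof (rule eq_vecI)
  let ?n = "a1 + a2 + a3 + (b1 + b2 + b3)"
  have dims: "dim_vec x1 = a1" "dim_vec x2 = a2" "dim_vec x3 = a3"
    "dim_vec y1 = b1" "dim_vec y2 = b2" "dim_vec y3 = b3"
    using assms by auto
  show "dim_vec (regroup_mat a1 a2 a3 b1 b2 b3 *\<^sub>v ?x) = dim_vec ?y"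
    by (simp add: regroup_mat_def dims Let_def)
  fix i assume "i < dim_vec ?y"
  then have i: "i < ?n"
    by (simp add: dims)
  have "?x \<in> carrier_vec ?n"
    by (rule carrier_vecI) (simp add: dims)
  then have "vec_index (regroup_mat a1 a2 a3 b1 b2 b3 *\<^sub>v ?x) i = vec_index ?x (regroup_index a1 a2 a3 b1 b2 i)"
    by (rule regroup_mat_mult_vec_index[OF _ i])
  also have "\<dots> = vec_index ?y i"
  proof -
    \<comment> \<open>There is one case for each of the six blocks of the target vector. Below,
      \<open>less_eqE\<close> writes \<open>i\<close> as the start of its block plus an offset, and
      both sides reduce to the same entry of that block.\<close>
    consider "i < a1" | "a1 \<le> i" "i < a1 + b1" | "a1 + b1 \<le> i" "i < a1 + b1 + a2"
      | "a1 + b1 + a2 \<le> i" "i < a1 + b1 + a2 + b2"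
      | "a1 + b1 + a2 + b2 \<le> i" "i < a1 + b1 + a2 + b2 + a3"
      | "a1 + b1 + a2 + b2 + a3 \<le> i"
      by linarith
    then show ?thesis
      using i by cases ((erule less_eqE)?, simp add: regroup_index_def dims)+
  qed
  finally show "vec_index (regroup_mat a1 a2 a3 b1 b2 b3 *\<^sub>v ?x) i = vec_index ?y i" .
qed

text \<open>The rows are distinct unit vectors, which gives \<open>P P^T = 1\<close>. For square
  matrices a right inverse is also a left inverse, and \<open>P^T P = 1\<close> is the order in
  which \<open>P\<close> gets cancelled later.\<close>

lemma regroup_mat_orthogonal:
  assumes n: "a1 + a2 + a3 + (b1 + b2 + b3) = n"
  shows "transpose_mat (regroup_mat a1 a2 a3 b1 b2 b3) * regroup_mat a1 a2 a3 b1 b2 b3 = 1\<^sub>m n"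
proof (rule mat_mult_left_right_inverse)
  let ?P = "regroup_mat a1 a2 a3 b1 b2 b3"
  show P: "?P \<in> carrier_mat n n" "transpose_mat ?P \<in> carrier_mat n n"
    using n by (auto simp: regroup_mat_carrier)
  show "?P * transpose_mat ?P = 1\<^sub>m n"
  proof (rule eq_matI)
    fix i j assume "i < dim_row (1\<^sub>m n :: real mat)" "j < dim_col (1\<^sub>m n :: real mat)"
    then have ij: "i < n" "j < n"
      by auto
    \<comment> \<open>Column \<open>j\<close> of the transpose is row \<open>j\<close> of
      \<open>?P\<close>, so this entry comes from permuting that row.\<close>
    have "(?P * transpose_mat ?P) $$ (i, j) = vec_index (?P *\<^sub>v row ?P j) i"
      using P ij by simp
    also have "\<dots> = vec_index (row ?P j) (regroup_index a1 a2 a3 b1 b2 i)"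
      using P ij n by (intro regroup_mat_mult_vec_index) auto
    also have "\<dots> = (1\<^sub>m n :: real mat) $$ (i, j)"
      using ij regroup_index_less[of i a1 a2 a3 b1 b2 b3] regroup_index_inj[of a1 a2 a3 b1 b2 i j]
      unfolding n by (auto simp: regroup_mat_def Let_def n)
    finally show "(?P * transpose_mat ?P) $$ (i, j) = (1\<^sub>m n :: real mat) $$ (i, j)" .
  qed (use P in auto)
qed

subsection \<open>Energy functions and curves on product spaces\<close>

text \<open>Applied with \<open>m\<close> and \<open>n\<close> the lengths of two stacked vectors,
  so that coordinatewise conditions can be checked on each part.\<close>

lemma all_less_add_iff: "(\<forall>i < m + n. Q i) \<longleftrightarrow> (\<forall>i < m. Q i) \<and> (\<forall>i < n. Q (m + i))" for m n :: nat
proof (intro iffI allI impI)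
  fix i assume Q: "(\<forall>i < m. Q i) \<and> (\<forall>i < n. Q (m + i))" and i: "i < m + n"
  show "Q i"
  proof (cases "i < m")
    case False
    then have "i - m < n" "m + (i - m) = i"
      using i by simp_all
    then show ?thesis
      using Q by metis
  qed (use Q in blast)
qed auto

lemma vec_index_append:
  assumes "v \<in> carrier_vec n" "w \<in> carrier_vec m"
  shows "i < n \<Longrightarrow> vec_index (v @\<^sub>v w) i = vec_index v i"
    and "i < m \<Longrightarrow> vec_index (v @\<^sub>v w) (n + i) = vec_index w i"
  using assms by auto

section \<open>Perturbed stacked vectors and gradients of separable energies\<close>

lemma vec_first_add: fixes x y :: "real vec" shows "dim_vec y = n + m \<Longrightarrow> vec_first (x + y) n = vec_first x n + vec_first y n"
  by (intro eq_vecI) (auto simp: vec_first_def)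

lemma vec_last_add:
  fixes x y :: "real vec"
  shows "dim_vec x = n + m \<Longrightarrow> dim_vec y = n + m \<Longrightarrow> vec_last (x + y) m = vec_last x m + vec_last y m"
  by (intro eq_vecI) (auto simp: vec_last_def)

lemma vec_first_smult_unit_vec:
  "i < n \<Longrightarrow> vec_first (s \<cdot>\<^sub>v unit_vec (n + m) i) n = s \<cdot>\<^sub>v unit_vec n i"
  "vec_first (s \<cdot>\<^sub>v unit_vec (n + m) (n + j)) n = (0\<^sub>v n :: real vec)"
  by (auto intro!: eq_vecI simp: vec_first_def unit_vec_def)

lemma vec_last_smult_unit_vec:
  "i < n \<Longrightarrow> vec_last (s \<cdot>\<^sub>v unit_vec (n + m) i) m = (0\<^sub>v m :: real vec)"
  "vec_last (s \<cdot>\<^sub>v unit_vec (n + m) (n + j)) m = s \<cdot>\<^sub>v unit_vec m j"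
  by (auto intro!: eq_vecI simp: vec_last_def unit_vec_def)

text \<open>A stacked vector does not record where its parts were joined, so the four dimensions
  tell where to cut both arguments.\<close>

definition separable_sum ::
  "nat \<Rightarrow> nat \<Rightarrow> nat \<Rightarrow> nat \<Rightarrow> (real vec \<Rightarrow> real vec \<Rightarrow> real) \<Rightarrow> (real vec \<Rightarrow> real vec \<Rightarrow> real) \<Rightarrow>
    real vec \<Rightarrow> real vec \<Rightarrow> real" where
  "separable_sum a1 a2 b1 b2 H K x y =
     H (vec_first x a1) (vec_first y a2) + K (vec_last x b1) (vec_last y b2)"

text \<open>With this symmetry every fact about the first argument transfers to the second.\<close>

lemma separable_sum_swap:
  "separable_sum a2 a1 b2 b1 (\<lambda>x y. H y x) (\<lambda>x y. K y x) x y = separable_sum a1 a2 b1 b2 H K y x"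
  by (simp add: separable_sum_def)

text \<open>A coordinate direction of the stacked vector moves only one summand. In both cases the
  moving summand is written first, so that \<open>has_field_derivative_add_const_iff\<close>
  applies.\<close>

lemma separable_sum_perturb:
  assumes "x \<in> carrier_vec (a1 + b1)"
  shows "i < a1 \<Longrightarrow> separable_sum a1 a2 b1 b2 H K (x + s \<cdot>\<^sub>v unit_vec (a1 + b1) i) y =
      H (vec_first x a1 + s \<cdot>\<^sub>v unit_vec a1 i) (vec_first y a2) + K (vec_last x b1) (vec_last y b2)"
    and "separable_sum a1 a2 b1 b2 H K (x + s \<cdot>\<^sub>v unit_vec (a1 + b1) (a1 + j)) y =
      K (vec_last x b1 + s \<cdot>\<^sub>v unit_vec b1 j) (vec_last y b2) + H (vec_first x a1) (vec_first y a2)"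
  using assms
  by (simp_all add: separable_sum_def vec_first_add[where m = b1] vec_last_add[where n = a1]
      vec_first_smult_unit_vec vec_last_smult_unit_vec)

text \<open>Being an equivalence for every \<open>D\<close>, it shows that \<open>deriv\<close>
  selects from the same set of derivatives with and without the constant. The gradient formulas
  therefore hold even where no derivative exists.\<close>

lemma has_field_derivative_add_const_iff:
  "((\<lambda>s. f s + c) has_field_derivative D) (at x within S) \<longleftrightarrow> (f has_field_derivative D) (at x within S)"
  using DERIV_diff[of "\<lambda>s. f s + c" D x S "\<lambda>s. c" 0] DERIV_add[of f D x S "\<lambda>s. c" 0] by auto

lemma grad1_separable_sum:
  assumes "x \<in> carrier_vec (a1 + b1)"
  shows "grad1 (a1 + b1) (separable_sum a1 a2 b1 b2 H K) x y =
    grad1 a1 H (vec_first x a1) (vec_first y a2) @\<^sub>v grad1 b1 K (vec_last x b1) (vec_last y b2)"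
proof (rule eq_vecI)
  fix i assume "i < dim_vec (grad1 a1 H (vec_first x a1) (vec_first y a2) @\<^sub>v
    grad1 b1 K (vec_last x b1) (vec_last y b2))"
  then have "i < a1 \<or> (\<exists>j. i = a1 + j \<and> j < b1)"
    by (auto simp: grad1_def) (metis add_less_cancel_left le_iff_add not_less)
  then show "vec_index (grad1 (a1 + b1) (separable_sum a1 a2 b1 b2 H K) x y) i =
    vec_index (grad1 a1 H (vec_first x a1) (vec_first y a2) @\<^sub>v
      grad1 b1 K (vec_last x b1) (vec_last y b2)) i"
    by (auto simp: grad1_def separable_sum_perturb[OF assms] deriv_def
        has_field_derivative_add_const_iff)
qed (simp add: grad1_def)

lemma grad2_eq_grad1: "grad2 n H x y = grad1 n (\<lambda>x y. H y x) y x"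
  by (simp add: grad1_def grad2_def)

lemma grad2_separable_sum:
  assumes "y \<in> carrier_vec (a2 + b2)"
  shows "grad2 (a2 + b2) (separable_sum a1 a2 b1 b2 H K) x y =
    grad2 a2 H (vec_first x a1) (vec_first y a2) @\<^sub>v grad2 b2 K (vec_last x b1) (vec_last y b2)"
  using grad1_separable_sum[OF assms, of a1 b1 "\<lambda>x y. H y x" "\<lambda>x y. K y x" x]
  unfolding grad2_eq_grad1 separable_sum_swap[of a2 a1 b2 b1 H K] .

section \<open>Continuity and continuous differentiability on the product space\<close>

lemma continuous_on_pairs_cong:
  assumes "\<And>x y. x \<in> carrier_vec n1 \<Longrightarrow> y \<in> carrier_vec n2 \<Longrightarrow> f x y = g x y"
  shows "continuous_on_pairs n1 n2 f \<longleftrightarrow> continuous_on_pairs n1 n2 g"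
  by (simp add: continuous_on_pairs_def assms)

lemma continuous_on_pairs_swap:
  "continuous_on_pairs n1 n2 f \<longleftrightarrow> continuous_on_pairs n2 n1 (\<lambda>x y. f y x)"
proof -
  have "continuous_on_pairs m2 m1 (\<lambda>x y. g y x)" if "continuous_on_pairs m1 m2 g" for m1 m2 g
    using continuous_on_compose2[OF that[unfolded continuous_on_pairs_def], of UNIV prod.swap]
    by (simp add: continuous_on_pairs_def case_prod_beta continuous_on_swap)
  from this[of n1 n2 f] this[of n2 n1 "\<lambda>x y. f y x"] show ?thesis
    by blast
qed

text \<open>Continuity is tested on sequences, and truncating a sequence to \<open>k + l\<close>
  entries and then to \<open>k\<close> is truncating it to \<open>k\<close>. The function on
  sequences is thus unchanged.\<close>

lemma continuous_on_pairs_first: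
  assumes "continuous_on_pairs a1 a2 f"
  shows "continuous_on_pairs (a1 + b1) (a2 + b2) (\<lambda>x y. f (vec_first x a1) (vec_first y a2))"
proof -
  have "vec_first (vec (k + l) p) k = vec k p" for k l and p :: "nat \<Rightarrow> real"
    by (auto simp: vec_first_def)
  with assms show ?thesis
    by (simp add: continuous_on_pairs_def)
qed

text \<open>The last entries of a truncated sequence are the first entries of a shifted one, and
  index shifts are continuous in the product topology.\<close>

lemma continuous_on_pairs_last:
  assumes "continuous_on_pairs b1 b2 f"
  shows "continuous_on_pairs (a1 + b1) (a2 + b2) (\<lambda>x y. f (vec_last x b1) (vec_last y b2))"
proof -
  have last: "vec_last (vec (k + l) p) l = vec l (\<lambda>i. p (k + i))" for k l and p :: "nat \<Rightarrow> real"
    by (auto simp: vec_last_def)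
  have coord: "continuous_on UNIV (\<lambda>x::(nat \<Rightarrow> real) \<times> (nat \<Rightarrow> real). fst x i)"
    "continuous_on UNIV (\<lambda>x::(nat \<Rightarrow> real) \<times> (nat \<Rightarrow> real). snd x i)" for i
    by (rule continuous_on_product_then_coordinatewise, intro continuous_intros)+
  have shift: "continuous_on UNIV
    (\<lambda>(p :: nat \<Rightarrow> real, q :: nat \<Rightarrow> real). (\<lambda>i. p (a1 + i), \<lambda>i. q (a2 + i)))"
    unfolding case_prod_beta
    by (intro continuous_on_Pair continuous_on_coordinatewise_then_product coord)
  show ?thesis
    using continuous_on_compose2[OF assms[unfolded continuous_on_pairs_def] shift]
    by (simp add: continuous_on_pairs_def last case_prod_beta)
qed

text \<open>One half of \<open>C1_on_pairs\<close>; the other half is the same condition with the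
  arguments exchanged.\<close>

definition C1_in_first :: "nat \<Rightarrow> nat \<Rightarrow> (real vec \<Rightarrow> real vec \<Rightarrow> real) \<Rightarrow> bool" where
  "C1_in_first n1 n2 H \<longleftrightarrow>
     (\<forall>i<n1. (\<forall>x\<in>carrier_vec n1. \<forall>y\<in>carrier_vec n2.
                (\<lambda>s. H (x + s \<cdot>\<^sub>v unit_vec n1 i) y) field_differentiable at 0)
           \<and> continuous_on_pairs n1 n2 (\<lambda>x y. vec_index (grad1 n1 H x y) i))"

lemma C1_on_pairs_iff:
  "C1_on_pairs n1 n2 H \<longleftrightarrow> C1_in_first n1 n2 H \<and> C1_in_first n2 n1 (\<lambda>x y. H y x)"
  unfolding C1_on_pairs_def C1_in_first_def grad2_eq_grad1
    continuous_on_pairs_swap[of n1 n2 "\<lambda>x y. vec_index (grad1 n2 (\<lambda>x y. H y x) y x) i" for i]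
  by blast

text \<open>In each coordinate direction one summand is constant, so differentiability and the
  partial derivative come from the other summand alone.\<close>

lemma C1_in_first_separable_sum:
  assumes H: "C1_in_first a1 a2 H" and K: "C1_in_first b1 b2 K"
  shows "C1_in_first (a1 + b1) (a2 + b2) (separable_sum a1 a2 b1 b2 H K)"
  unfolding C1_in_first_def all_less_add_iff
proof (intro conjI allI impI ballI)
  fix i and x y :: "real vec"
  assume i: "i < a1" and x: "x \<in> carrier_vec (a1 + b1)" and y: "y \<in> carrier_vec (a2 + b2)"
  show "(\<lambda>s. separable_sum a1 a2 b1 b2 H K (x + s \<cdot>\<^sub>v unit_vec (a1 + b1) i) y)
    field_differentiable at 0"
    using H i unfolding C1_in_first_def separable_sum_perturb(1)[OF x i] field_differentiable_def
    by (simp add: has_field_derivative_add_const_iff)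
next
  fix i and x y :: "real vec"
  assume i: "i < b1" and x: "x \<in> carrier_vec (a1 + b1)" and y: "y \<in> carrier_vec (a2 + b2)"
  show "(\<lambda>s. separable_sum a1 a2 b1 b2 H K (x + s \<cdot>\<^sub>v unit_vec (a1 + b1) (a1 + i)) y)
    field_differentiable at 0"
    using K i unfolding C1_in_first_def separable_sum_perturb(2)[OF x] field_differentiable_def
    by (simp add: has_field_derivative_add_const_iff)
next
  fix i assume i: "i < a1"
  then have "continuous_on_pairs a1 a2 (\<lambda>x y. vec_index (grad1 a1 H x y) i)"
    using H by (simp add: C1_in_first_def)
  from continuous_on_pairs_first[OF this, of b1 b2] i
  show "continuous_on_pairs (a1 + b1) (a2 + b2)
    (\<lambda>x y. vec_index (grad1 (a1 + b1) (separable_sum a1 a2 b1 b2 H K) x y) i)"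
    by (subst continuous_on_pairs_cong) (auto simp: grad1_separable_sum, auto simp: grad1_def)
next
  fix i assume i: "i < b1"
  then have "continuous_on_pairs b1 b2 (\<lambda>x y. vec_index (grad1 b1 K x y) i)"
    using K by (simp add: C1_in_first_def)
  from continuous_on_pairs_last[OF this, of a1 a2] i
  show "continuous_on_pairs (a1 + b1) (a2 + b2)
    (\<lambda>x y. vec_index (grad1 (a1 + b1) (separable_sum a1 a2 b1 b2 H K) x y) (a1 + i))"
    by (subst continuous_on_pairs_cong) (auto simp: grad1_separable_sum, auto simp: grad1_def)
qed

lemma C1_on_pairs_separable_sum:
  assumes "C1_on_pairs a1 a2 H" "C1_on_pairs b1 b2 K"
  shows "C1_on_pairs (a1 + b1) (a2 + b2) (separable_sum a1 a2 b1 b2 H K)"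
  using assms C1_in_first_separable_sum[of a1 a2 H b1 b2 K]
    C1_in_first_separable_sum[of a2 a1 "\<lambda>x y. H y x" b2 b1 "\<lambda>x y. K y x"]
  unfolding C1_on_pairs_iff separable_sum_swap[of a2 a1 b2 b1 H K] by blast

section \<open>Concatenated curves\<close>

lemma C0_curve_cong:
  "(\<And>t. t \<in> T \<Longrightarrow> f t = g t) \<Longrightarrow> C0_curve n T f \<longleftrightarrow> C0_curve n T g"
  by (simp add: C0_curve_def Pi_iff cong: continuous_on_cong)

lemma C0_curve_append:
  assumes f: "f \<in> T \<rightarrow> carrier_vec n" and g: "g \<in> T \<rightarrow> carrier_vec m"
  shows "C0_curve (n + m) T (\<lambda>s. f s @\<^sub>v g s) \<longleftrightarrow> C0_curve n T f \<and> C0_curve m T g"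
proof -
  have "continuous_on T (\<lambda>s. vec_index (f s @\<^sub>v g s) i) \<longleftrightarrow> continuous_on T (\<lambda>s. vec_index (f s) i)"
    if "i < n" for i
    using f g that by (intro continuous_on_cong) (auto simp: Pi_iff vec_index_append[of _ n _ m])
  moreover have "continuous_on T (\<lambda>s. vec_index (f s @\<^sub>v g s) (n + i)) \<longleftrightarrow>
    continuous_on T (\<lambda>s. vec_index (g s) i)" if "i < m" for i
    using f g that by (intro continuous_on_cong) (auto simp: Pi_iff vec_index_append[of _ n _ m])
  moreover have "(\<lambda>s. f s @\<^sub>v g s) \<in> T \<rightarrow> carrier_vec (n + m)"
    using f g by (auto simp: Pi_iff)
  ultimately show ?thesis
    using f g by (simp add: C0_curve_def all_less_add_iff)
qed

text \<open>The lengths of \<open>f s\<close> and \<open>g s\<close> are known only for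
  \<open>s\<close> in \<open>T\<close>. This is enough, because the derivative within
  \<open>T\<close> at a point of \<open>T\<close> depends only on the values on
  \<open>T\<close>.\<close>

lemma curve_deriv_append:
  assumes f: "f \<in> T \<rightarrow> carrier_vec n" and g: "g \<in> T \<rightarrow> carrier_vec m" and t: "t \<in> T"
  shows "curve_deriv (n + m) T (\<lambda>s. f s @\<^sub>v g s) t = curve_deriv n T f t @\<^sub>v curve_deriv m T g t"
proof (rule eq_vecI)
  have dims: "dim_vec (f s) = n" "dim_vec (g s) = m" if "s \<in> T" for s
    using f g that by (auto simp: Pi_iff)
  fix i assume "i < dim_vec (curve_deriv n T f t @\<^sub>v curve_deriv m T g t)"
  then have i: "i < n + m"
    by (simp add: curve_deriv_def)
  have "vector_derivative (\<lambda>s. vec_index (f s @\<^sub>v g s) i) (at t within T) =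
    vector_derivative (\<lambda>s. if i < n then vec_index (f s) i else vec_index (g s) (i - n)) (at t within T)"
    using t i by (intro vector_derivative_cong_eq always_eventually) (auto simp: dims)
  with i show "vec_index (curve_deriv (n + m) T (\<lambda>s. f s @\<^sub>v g s) t) i =
    vec_index (curve_deriv n T f t @\<^sub>v curve_deriv m T g t) i"
    by (auto simp: curve_deriv_def)
qed (simp add: curve_deriv_def)

lemma C1_curve_append:
  assumes f: "f \<in> T \<rightarrow> carrier_vec n" and g: "g \<in> T \<rightarrow> carrier_vec m"
  shows "C1_curve (n + m) T (\<lambda>s. f s @\<^sub>v g s) \<longleftrightarrow> C1_curve n T f \<and> C1_curve m T g"
proof -
  \<comment> \<open>The functions agree on all of \<open>T\<close>, so any positive radius works; 1
    is an arbitrary choice.\<close>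
  have imp: "k differentiable_on T"
    if "h differentiable_on T" "\<And>s. s \<in> T \<Longrightarrow> h s = k s" for h k :: "real \<Rightarrow> real"
    using that unfolding differentiable_on_def
    by (auto intro: differentiable_transform_within[where d = 1])
  have cong: "h differentiable_on T \<longleftrightarrow> k differentiable_on T"
    if "\<And>s. s \<in> T \<Longrightarrow> h s = k s" for h k :: "real \<Rightarrow> real"
    using imp[of h k] imp[of k h] that by auto
  have "(\<lambda>s. vec_index (f s @\<^sub>v g s) i) differentiable_on T \<longleftrightarrow>
    (\<lambda>s. vec_index (f s) i) differentiable_on T" if "i < n" for i
    using f g that by (intro cong) (auto simp: Pi_iff vec_index_append[of _ n _ m])
  moreover have "(\<lambda>s. vec_index (f s @\<^sub>v g s) (n + i)) differentiable_on T \<longleftrightarrow>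
    (\<lambda>s. vec_index (g s) i) differentiable_on T" if "i < m" for i
    using f g that by (intro cong) (auto simp: Pi_iff vec_index_append[of _ n _ m])
  moreover have "C0_curve (n + m) T (curve_deriv (n + m) T (\<lambda>s. f s @\<^sub>v g s)) \<longleftrightarrow>
    C0_curve n T (curve_deriv n T f) \<and> C0_curve m T (curve_deriv m T g)"
    by (subst C0_curve_append[symmetric])
      (auto simp: curve_deriv_def[of n] curve_deriv_def[of m] curve_deriv_append[OF f g] intro!: C0_curve_cong)
  moreover have "(\<lambda>s. f s @\<^sub>v g s) \<in> T \<rightarrow> carrier_vec (n + m)"
    using f g by (auto simp: Pi_iff)
  ultimately show ?thesis
    using f g by (auto simp: C1_curve_def all_less_add_iff)
qed

section \<open>Linear algebra of the change of coordinates and of the feedback\<close>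

lemma skew_add:
  fixes A B :: "real mat"
  assumes A: "A \<in> carrier_mat n n" "A = - transpose_mat A"
    and B: "B \<in> carrier_mat n n" "B = - transpose_mat B"
  shows "A + B = - transpose_mat (A + B)"
proof -
  have "transpose_mat A = - A" "transpose_mat B = - B"
    by (subst A(2), simp add: transpose_uminus, subst B(2), simp add: transpose_uminus)
  then have "transpose_mat (A + B) = - A + - B"
    using A(1) B(1) by (simp add: transpose_add[of A n n B])
  then show ?thesis
    using A(1) B(1) by (auto intro!: eq_matI)
qed

lemma vec_first_append: "x \<in> carrier_vec n \<Longrightarrow> vec_first (x @\<^sub>v y) n = x"
  by (auto intro!: eq_vecI simp: vec_first_def)

lemma vec_last_append: "y \<in> carrier_vec m \<Longrightarrow> vec_last (x @\<^sub>v y) m = y"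
  by (auto intro!: eq_vecI simp: vec_last_def)

text \<open>Since \<open>P^T P\<close> cancels, each conjugated matrix acts on \<open>P f\<close> as
  \<open>P\<close> times the original action. The whole right-hand side is then \<open>P\<close>
  times the original one, and \<open>P\<close> is injective.\<close>

lemma orthogonal_transform_equation:
  fixes P J R B :: "real mat"
  assumes P: "P \<in> carrier_mat n n" "transpose_mat P * P = 1\<^sub>m n"
    and J: "J \<in> carrier_mat n n" and R: "R \<in> carrier_mat n n" and B: "B \<in> carrier_mat n m"
    and f: "f \<in> carrier_vec n" and g: "g \<in> carrier_vec n" and v: "v \<in> carrier_vec m"
  shows "P *\<^sub>v g = (P * J * transpose_mat P - P * R * transpose_mat P) *\<^sub>v (P *\<^sub>v f) + P * B *\<^sub>v v \<longleftrightarrow>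
    g = (J - R) *\<^sub>v f + B *\<^sub>v v" (is "?l = ?r \<longleftrightarrow> _")
    and "transpose_mat (P * B) *\<^sub>v (P *\<^sub>v f) = transpose_mat B *\<^sub>v f"
proof -
  have Pt: "transpose_mat P \<in> carrier_mat n n"
    using P by simp
  have cancel: "transpose_mat P *\<^sub>v (P *\<^sub>v x) = x" if "x \<in> carrier_vec n" for x
    using that P by (simp add: assoc_mult_mat_vec[of "transpose_mat P" n n P n x, symmetric])
  have conj: "P * M * transpose_mat P *\<^sub>v (P *\<^sub>v f) = P *\<^sub>v (M *\<^sub>v f)" if "M \<in> carrier_mat n n" for M
    using that P f cancel[OF f] by (simp add: assoc_mult_mat_vec[of _ n n _ n] del: assoc_mult_mat)
  have carr: "P * M * transpose_mat P \<in> carrier_mat n n" if "M \<in> carrier_mat n n" for M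
    using that P by simp
  have "?r = P *\<^sub>v (J *\<^sub>v f) - P *\<^sub>v (R *\<^sub>v f) + P *\<^sub>v (B *\<^sub>v v)"
    using P(1) f conj[OF J] conj[OF R] assoc_mult_mat_vec[OF P(1) B v]
    by (simp add: minus_mult_distrib_mat_vec[OF carr[OF J] carr[OF R]] del: assoc_mult_mat)
  also have "\<dots> = P *\<^sub>v ((J - R) *\<^sub>v f + B *\<^sub>v v)"
    using P J R B f v
    by (simp add: minus_mult_distrib_mat_vec[of _ n n] mult_add_distrib_mat_vec[of _ n n]
        mult_minus_distrib_mat_vec[of _ n n])
  finally have r: "?r = P *\<^sub>v ((J - R) *\<^sub>v f + B *\<^sub>v v)" .
  have "(J - R) *\<^sub>v f + B *\<^sub>v v \<in> carrier_vec n"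
    using R B f v by (metis add_carrier_vec mult_mat_vec_carrier minus_carrier_mat)
  from cancel[OF this] cancel[OF g] show "?l = ?r \<longleftrightarrow> g = (J - R) *\<^sub>v f + B *\<^sub>v v"
    unfolding r by metis
  show "transpose_mat (P * B) *\<^sub>v (P *\<^sub>v f) = transpose_mat B *\<^sub>v f"
    using P B f cancel[OF f] by (simp add: transpose_mult[of P n n B m])
qed

text \<open>Regrouping \<open>B K B^T f\<close> as \<open>B (K (B^T f))\<close>, and likewise for
  \<open>L\<close>, trades the modified structure matrices for a feedback in the input.\<close>

lemma output_feedback:
  fixes J R B K L :: "real mat"
  assumes J: "J \<in> carrier_mat n n" and R: "R \<in> carrier_mat n n" and B: "B \<in> carrier_mat n m"
    and K: "K \<in> carrier_mat m m" and L: "L \<in> carrier_mat m m"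
    and f: "f \<in> carrier_vec n" and v: "v \<in> carrier_vec m"
  shows "(J + B * K * transpose_mat B - (R + B * L * transpose_mat B)) *\<^sub>v f + B *\<^sub>v v =
    (J - R) *\<^sub>v f + B *\<^sub>v ((K - L) *\<^sub>v (transpose_mat B *\<^sub>v f) + v)"
proof -
  have w: "transpose_mat B *\<^sub>v f \<in> carrier_vec m"
    using B f by simp
  have prod: "B * M * transpose_mat B *\<^sub>v f = B *\<^sub>v (M *\<^sub>v (transpose_mat B *\<^sub>v f))"
    if "M \<in> carrier_mat m m" for M
    using that B f by (simp add: assoc_mult_mat_vec[of _ n m _ n] assoc_mult_mat_vec[of _ n m _ m]
        del: assoc_mult_mat)
  have carr: "B * M * transpose_mat B \<in> carrier_mat n n" if "M \<in> carrier_mat m m" for M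
    using that B by simp
  show ?thesis
    using J R B K L f v w carr[OF K] carr[OF L]
    by (intro eq_vecI) (simp_all add: minus_mult_distrib_mat_vec[of _ n n] add_mult_distrib_mat_vec[of _ n n]
        minus_mult_distrib_mat_vec[of _ m m] mult_add_distrib_mat_vec[of _ n m]
        mult_minus_distrib_mat_vec[of _ n m] prod del: assoc_mult_mat index_mult_mat_vec)
qed

subsection \<open>The interconnected system\<close>

definition joint_regroup :: "eb_system \<Rightarrow> eb_system \<Rightarrow> real mat" where
  "joint_regroup S1 S2 =
     regroup_mat (dim_z1 S1) (dim_z2 S1) (dim_z3 S1) (dim_z1 S2) (dim_z2 S2) (dim_z3 S2)"

definition joint_B :: "eb_system \<Rightarrow> eb_system \<Rightarrow> real mat" where
  "joint_B S1 S2 = block_diag (mat_B S1) (mat_B S2)"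

text \<open>With \<open>P\<close> and \<open>B\<close> the joint matrices, the feedback terms are
  \<open>(P B) K (P B)^T\<close> and \<open>(P B) L (P B)^T\<close>. No permutation occurs in
  \<open>mat_E\<close>, which acts on the stacked second component only.\<close>

definition interconnection :: "eb_system \<Rightarrow> eb_system \<Rightarrow> real mat \<Rightarrow> real mat \<Rightarrow> eb_system" where
  "interconnection S1 S2 K L =
   \<lparr>dim_z1 = dim_z1 S1 + dim_z1 S2,
    dim_z2 = dim_z2 S1 + dim_z2 S2,
    dim_z3 = dim_z3 S1 + dim_z3 S2,
    dim_io = dim_io S1 + dim_io S2,
    energy = separable_sum (dim_z1 S1) (dim_z2 S1) (dim_z1 S2) (dim_z2 S2) (energy S1) (energy S2),
    effort = (\<lambda>x y. effort S1 (vec_first x (dim_z1 S1)) (vec_first y (dim_z2 S1)) @\<^sub>v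
      effort S2 (vec_last x (dim_z1 S2)) (vec_last y (dim_z2 S2))),
    mat_E = block_diag (mat_E S1) (mat_E S2),
    mat_J = joint_regroup S1 S2 *
      (block_diag (mat_J S1) (mat_J S2) + joint_B S1 S2 * K * transpose_mat (joint_B S1 S2)) *
      transpose_mat (joint_regroup S1 S2),
    mat_R = joint_regroup S1 S2 *
      (block_diag (mat_R S1) (mat_R S2) + joint_B S1 S2 * L * transpose_mat (joint_B S1 S2)) *
      transpose_mat (joint_regroup S1 S2),
    mat_B = joint_regroup S1 S2 * joint_B S1 S2\<rparr>"

lemma interconnection_simps [simp]:
  "dim_z1 (interconnection S1 S2 K L) = dim_z1 S1 + dim_z1 S2"
  "dim_z2 (interconnection S1 S2 K L) = dim_z2 S1 + dim_z2 S2"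
  "dim_z3 (interconnection S1 S2 K L) = dim_z3 S1 + dim_z3 S2"
  "dim_io (interconnection S1 S2 K L) = dim_io S1 + dim_io S2"
  by (simp_all add: interconnection_def)

section \<open>Structural conditions for the interconnected system\<close>

lemma energy_based_form_carrier:
  assumes "energy_based_form S"
  shows "mat_E S \<in> carrier_mat (dim_z2 S) (dim_z2 S)"
    and "mat_J S \<in> carrier_mat (dim_total S) (dim_total S)"
    and "mat_R S \<in> carrier_mat (dim_total S) (dim_total S)"
    and "mat_B S \<in> carrier_mat (dim_total S) (dim_io S)"
    and "x \<in> carrier_vec (dim_z1 S) \<Longrightarrow> y \<in> carrier_vec (dim_z2 S) \<Longrightarrow>
      effort S x y \<in> carrier_vec (dim_z2 S)"
  using assms by (auto simp: energy_based_form_def)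

lemma joint_regroup_carrier:
  "joint_regroup S1 S2 \<in> carrier_mat (dim_total S1 + dim_total S2) (dim_total S1 + dim_total S2)"
  by (simp add: joint_regroup_def regroup_mat_carrier)

lemma joint_B_carrier:
  assumes "energy_based_form S1" "energy_based_form S2"
  shows "joint_B S1 S2 \<in> carrier_mat (dim_total S1 + dim_total S2) (dim_io S1 + dim_io S2)"
  unfolding joint_B_def using assms[THEN energy_based_form_carrier(4)] by (rule block_diag_carrier)

lemma continuous_on_pairs_effort_append:
  assumes S1: "energy_based_form S1" and S2: "energy_based_form S2"
    and i: "i < dim_z2 S1 + dim_z2 S2"
  shows "continuous_on_pairs (dim_z1 S1 + dim_z1 S2) (dim_z2 S1 + dim_z2 S2)
    (\<lambda>x y. vec_index (effort S1 (vec_first x (dim_z1 S1)) (vec_first y (dim_z2 S1)) @\<^sub>v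
      effort S2 (vec_last x (dim_z1 S2)) (vec_last y (dim_z2 S2))) i)"
proof -
  have "\<forall>i < dim_z2 S1 + dim_z2 S2.
    continuous_on_pairs (dim_z1 S1 + dim_z1 S2) (dim_z2 S1 + dim_z2 S2)
      (\<lambda>x y. vec_index (effort S1 (vec_first x (dim_z1 S1)) (vec_first y (dim_z2 S1)) @\<^sub>v
        effort S2 (vec_last x (dim_z1 S2)) (vec_last y (dim_z2 S2))) i)"
    unfolding all_less_add_iff
  proof (intro conjI allI impI)
    fix i assume i: "i < dim_z2 S1"
    then have "continuous_on_pairs (dim_z1 S1) (dim_z2 S1) (\<lambda>x y. vec_index (effort S1 x y) i)"
      using S1 by (simp add: energy_based_form_def)
    from continuous_on_pairs_first[OF this]
    show "continuous_on_pairs (dim_z1 S1 + dim_z1 S2) (dim_z2 S1 + dim_z2 S2)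
      (\<lambda>x y. vec_index (effort S1 (vec_first x (dim_z1 S1)) (vec_first y (dim_z2 S1)) @\<^sub>v
        effort S2 (vec_last x (dim_z1 S2)) (vec_last y (dim_z2 S2))) i)"
      using i energy_based_form_carrier(5)[OF S1] energy_based_form_carrier(5)[OF S2]
      by (simp add: vec_index_append[of _ "dim_z2 S1" _ "dim_z2 S2"])
  next
    fix i assume i: "i < dim_z2 S2"
    then have "continuous_on_pairs (dim_z1 S2) (dim_z2 S2) (\<lambda>x y. vec_index (effort S2 x y) i)"
      using S2 by (simp add: energy_based_form_def)
    from continuous_on_pairs_last[OF this]
    show "continuous_on_pairs (dim_z1 S1 + dim_z1 S2) (dim_z2 S1 + dim_z2 S2)
      (\<lambda>x y. vec_index (effort S1 (vec_first x (dim_z1 S1)) (vec_first y (dim_z2 S1)) @\<^sub>v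
        effort S2 (vec_last x (dim_z1 S2)) (vec_last y (dim_z2 S2))) (dim_z2 S1 + i))"
      using i energy_based_form_carrier(5)[OF S1] energy_based_form_carrier(5)[OF S2]
      by (simp add: vec_index_append[of _ "dim_z2 S1" _ "dim_z2 S2"])
  qed
  with i show ?thesis
    by blast
qed

text \<open>Skewness, symmetry and semi-definiteness pass through two congruences: by the input
  matrix for the feedback terms, then by the permutation for the sums. The relation between effort
  and energy holds blockwise.\<close>

lemma energy_based_form_interconnection:
  assumes S1: "energy_based_form S1" and S2: "energy_based_form S2"
    and K: "K \<in> carrier_mat (dim_io S1 + dim_io S2) (dim_io S1 + dim_io S2)" "K = - transpose_mat K"
    and L: "L \<in> carrier_mat (dim_io S1 + dim_io S2) (dim_io S1 + dim_io S2)" "L = transpose_mat L"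
      "pos_semidef (dim_io S1 + dim_io S2) L"
  shows "energy_based_form (interconnection S1 S2 K L)"
proof -
  let ?P = "joint_regroup S1 S2" and ?B = "joint_B S1 S2"
  let ?n = "dim_total S1 + dim_total S2"
  let ?J = "block_diag (mat_J S1) (mat_J S2)" and ?R = "block_diag (mat_R S1) (mat_R S2)"
  let ?S = "interconnection S1 S2 K L"
  note carr = energy_based_form_carrier[OF S1] energy_based_form_carrier[OF S2]
  have n: "dim_total ?S = ?n"
    by simp
  have P: "?P \<in> carrier_mat ?n ?n"
    by (rule joint_regroup_carrier)
  have B: "?B \<in> carrier_mat ?n (dim_io S1 + dim_io S2)"
    by (rule joint_B_carrier[OF S1 S2])
  have J: "?J \<in> carrier_mat ?n ?n" and R: "?R \<in> carrier_mat ?n ?n"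
    using carr by blast+
  have BK: "?B * K * transpose_mat ?B \<in> carrier_mat ?n ?n"
    and BL: "?B * L * transpose_mat ?B \<in> carrier_mat ?n ?n"
    using B K(1) L(1) by simp_all
  have J0: "?J + ?B * K * transpose_mat ?B \<in> carrier_mat ?n ?n"
    and R0: "?R + ?B * L * transpose_mat ?B \<in> carrier_mat ?n ?n"
    using J R BK BL by simp_all
  have "?J = - transpose_mat ?J"
    unfolding block_diag_transpose block_diag_uminus using S1 S2
    by (metis energy_based_form_def)
  then have skew: "mat_J ?S = - transpose_mat (mat_J ?S)"
    using skew_congruence[OF J0 P skew_add[OF J _ BK skew_congruence[OF K(1) B K(2)]]]
    by (simp add: interconnection_def)
  have "?R = transpose_mat ?R"
    unfolding block_diag_transpose using S1 S2 by (metis energy_based_form_def)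
  then have "?R + ?B * L * transpose_mat ?B = transpose_mat (?R + ?B * L * transpose_mat ?B)"
    using sym_congruence[OF L(1) B L(2)] transpose_add[OF R BL] by metis
  from sym_congruence[OF R0 P this] have sym: "mat_R ?S = transpose_mat (mat_R ?S)"
    by (simp add: interconnection_def)
  have "pos_semidef ?n ?R"
    using S1 S2 by (intro pos_semidef_block_diag carr) (auto simp: energy_based_form_def)
  from pos_semidef_congruence[OF R0 P
      pos_semidef_add[OF R BL this pos_semidef_congruence[OF L(1) B L(3)]]]
  have psd: "pos_semidef (dim_total ?S) (mat_R ?S)"
    unfolding n by (simp add: interconnection_def)
  have C1: "C1_on_pairs (dim_z1 ?S) (dim_z2 ?S) (energy ?S)"
    using S1 S2 C1_on_pairs_separable_sum by (simp add: interconnection_def energy_based_form_def)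
  have effort: "effort ?S x y \<in> carrier_vec (dim_z2 ?S)"
    "transpose_mat (mat_E ?S) *\<^sub>v effort ?S x y = grad2 (dim_z2 ?S) (energy ?S) x y"
    if "x \<in> carrier_vec (dim_z1 ?S)" "y \<in> carrier_vec (dim_z2 ?S)" for x y
  proof -
    show "effort ?S x y \<in> carrier_vec (dim_z2 ?S)"
      using carr(5,10) by (simp add: interconnection_def)
    have "transpose_mat (mat_E S1) *\<^sub>v effort S1 x' y' = grad2 (dim_z2 S1) (energy S1) x' y'"
      if "x' \<in> carrier_vec (dim_z1 S1)" "y' \<in> carrier_vec (dim_z2 S1)" for x' y'
      using S1 that by (simp add: energy_based_form_def)
    moreover have "transpose_mat (mat_E S2) *\<^sub>v effort S2 x' y' = grad2 (dim_z2 S2) (energy S2) x' y'"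
      if "x' \<in> carrier_vec (dim_z1 S2)" "y' \<in> carrier_vec (dim_z2 S2)" for x' y'
      using S2 that by (simp add: energy_based_form_def)
    ultimately show "transpose_mat (mat_E ?S) *\<^sub>v effort ?S x y = grad2 (dim_z2 ?S) (energy ?S) x y"
      using that carr
      by (simp add: interconnection_def block_diag_transpose grad2_separable_sum
          block_diag_mult_append[of _ "dim_z2 S1" "dim_z2 S1" _ "dim_z2 S2" "dim_z2 S2"])
  qed
  have "mat_J ?S \<in> carrier_mat (dim_total ?S) (dim_total ?S)"
    "mat_R ?S \<in> carrier_mat (dim_total ?S) (dim_total ?S)"
    "mat_B ?S \<in> carrier_mat (dim_total ?S) (dim_io ?S)"
    unfolding n using P J0 R0 B by (simp_all add: interconnection_def)
  moreover have "mat_E ?S \<in> carrier_mat (dim_z2 ?S) (dim_z2 ?S)"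
    using carr by (auto simp: interconnection_def)
  moreover have "\<forall>i<dim_z2 ?S. continuous_on_pairs (dim_z1 ?S) (dim_z2 ?S)
    (\<lambda>x y. vec_index (effort ?S x y) i)"
    using continuous_on_pairs_effort_append[OF S1 S2] by (simp add: interconnection_def)
  ultimately show ?thesis
    unfolding energy_based_form_def using C1 effort skew sym psd by blast
qed

text \<open>The inputs are fixed here and tied to the outputs by the interconnection law. The
  combined equations are reduced in three moves: cancel the permutation, turn the feedback terms
  back into the inputs, and separate the two concatenated parts.\<close>

lemma eb_equations_interconnection:
  assumes S1: "energy_based_form S1" and S2: "energy_based_form S2"
    and K: "K \<in> carrier_mat (dim_io S1 + dim_io S2) (dim_io S1 + dim_io S2)"
    and L: "L \<in> carrier_mat (dim_io S1 + dim_io S2) (dim_io S1 + dim_io S2)"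
    and z: "z1 \<in> states S1" "z2 \<in> states S2" and dz: "dz1 \<in> states S1" "dz2 \<in> states S2"
    and u: "u1 \<in> carrier_vec (dim_io S1)" "u2 \<in> carrier_vec (dim_io S2)"
    and v: "v1 \<in> carrier_vec (dim_io S1)" "v2 \<in> carrier_vec (dim_io S2)"
    and y: "y1 \<in> carrier_vec (dim_io S1)" "y2 \<in> carrier_vec (dim_io S2)"
    and inter: "interconnected (K - L) u1 u2 y1 y2 v1 v2"
  shows "eb_equations S1 z1 dz1 u1 y1 \<and> eb_equations S2 z2 dz2 u2 y2 \<longleftrightarrow>
    eb_equations (interconnection S1 S2 K L) (stack z1 z2) (stack dz1 dz2) (v1 @\<^sub>v v2) (y1 @\<^sub>v y2)"
proof -
  let ?P = "joint_regroup S1 S2" and ?B = "joint_B S1 S2"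
  let ?S = "interconnection S1 S2 K L"
  let ?n = "dim_total S1 + dim_total S2"
  let ?J = "block_diag (mat_J S1) (mat_J S2)" and ?R = "block_diag (mat_R S1) (mat_R S2)"
  note carr = energy_based_form_carrier[OF S1] energy_based_form_carrier[OF S2]
  obtain a1 a2 a3 where z1: "z1 = (a1, a2, a3)" "a1 \<in> carrier_vec (dim_z1 S1)"
    "a2 \<in> carrier_vec (dim_z2 S1)" "a3 \<in> carrier_vec (dim_z3 S1)"
    using z(1) by (auto simp: states_def)
  obtain b1 b2 b3 where z2: "z2 = (b1, b2, b3)" "b1 \<in> carrier_vec (dim_z1 S2)"
    "b2 \<in> carrier_vec (dim_z2 S2)" "b3 \<in> carrier_vec (dim_z3 S2)"
    using z(2) by (auto simp: states_def)
  obtain c1 c2 c3 where dz1: "dz1 = (c1, c2, c3)" "c1 \<in> carrier_vec (dim_z1 S1)"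
    "c2 \<in> carrier_vec (dim_z2 S1)" "c3 \<in> carrier_vec (dim_z3 S1)"
    using dz(1) by (auto simp: states_def)
  obtain d1 d2 d3 where dz2: "dz2 = (d1, d2, d3)" "d1 \<in> carrier_vec (dim_z1 S2)"
    "d2 \<in> carrier_vec (dim_z2 S2)" "d3 \<in> carrier_vec (dim_z3 S2)"
    using dz(2) by (auto simp: states_def)
  \<comment> \<open>The vectors \<open>f1\<close>, \<open>f2\<close> are those multiplied by the
    structure matrices, and \<open>g1\<close>, \<open>g2\<close> are the left-hand sides of the two
    systems.\<close>
  define f1 where "f1 = c1 @\<^sub>v effort S1 a1 a2 @\<^sub>v a3"
  define f2 where "f2 = d1 @\<^sub>v effort S2 b1 b2 @\<^sub>v b3"
  define g1 where "g1 = grad1 (dim_z1 S1) (energy S1) a1 a2 @\<^sub>v (mat_E S1 *\<^sub>v c2) @\<^sub>v 0\<^sub>v (dim_z3 S1)"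
  define g2 where "g2 = grad1 (dim_z1 S2) (energy S2) b1 b2 @\<^sub>v (mat_E S2 *\<^sub>v d2) @\<^sub>v 0\<^sub>v (dim_z3 S2)"
  have e: "effort S1 a1 a2 \<in> carrier_vec (dim_z2 S1)" "effort S2 b1 b2 \<in> carrier_vec (dim_z2 S2)"
    using carr z1 z2 by auto
  have grad: "grad1 k H p q \<in> carrier_vec k" for k H p q
    by (simp add: grad1_def)
  have E: "mat_E S1 *\<^sub>v c2 \<in> carrier_vec (dim_z2 S1)" "mat_E S2 *\<^sub>v d2 \<in> carrier_vec (dim_z2 S2)"
    using carr dz1 dz2 by auto
  have f: "f1 \<in> carrier_vec (dim_total S1)" "f2 \<in> carrier_vec (dim_total S2)"
    unfolding f1_def f2_def add.assoc using e z1 z2 dz1 dz2 by (auto intro!: append_carrier_vec)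
  have g: "g1 \<in> carrier_vec (dim_total S1)" "g2 \<in> carrier_vec (dim_total S2)"
    unfolding g1_def g2_def add.assoc using E grad by (auto intro!: append_carrier_vec)
  have effort_S: "effort ?S (a1 @\<^sub>v b1) (a2 @\<^sub>v b2) = effort S1 a1 a2 @\<^sub>v effort S2 b1 b2"
    using z1 z2 by (simp add: interconnection_def vec_first_append vec_last_append)
  have f_S: "(c1 @\<^sub>v d1) @\<^sub>v effort ?S (a1 @\<^sub>v b1) (a2 @\<^sub>v b2) @\<^sub>v (a3 @\<^sub>v b3) = ?P *\<^sub>v (f1 @\<^sub>v f2)"
    unfolding effort_S f1_def f2_def joint_regroup_def
    using e z1 z2 dz1 dz2 by (intro regroup_mat_append[symmetric])
  have "grad1 (dim_z1 ?S) (energy ?S) (a1 @\<^sub>v b1) (a2 @\<^sub>v b2) =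
    grad1 (dim_z1 S1) (energy S1) a1 a2 @\<^sub>v grad1 (dim_z1 S2) (energy S2) b1 b2"
    using z1 z2
    by (simp add: interconnection_def grad1_separable_sum vec_first_append vec_last_append)
  moreover have "mat_E ?S *\<^sub>v (c2 @\<^sub>v d2) = (mat_E S1 *\<^sub>v c2) @\<^sub>v (mat_E S2 *\<^sub>v d2)"
    using dz1 dz2 carr by (simp add: interconnection_def block_diag_mult_append)
  moreover have "0\<^sub>v (dim_z3 ?S) = 0\<^sub>v (dim_z3 S1) @\<^sub>v (0\<^sub>v (dim_z3 S2) :: real vec)"
    by (intro eq_vecI) auto
  ultimately have g_S: "grad1 (dim_z1 ?S) (energy ?S) (a1 @\<^sub>v b1) (a2 @\<^sub>v b2) @\<^sub>v
    (mat_E ?S *\<^sub>v (c2 @\<^sub>v d2)) @\<^sub>v 0\<^sub>v (dim_z3 ?S) = ?P *\<^sub>v (g1 @\<^sub>v g2)"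
    unfolding g1_def g2_def joint_regroup_def
    using E grad by (simp add: regroup_mat_append)
  have P: "?P \<in> carrier_mat ?n ?n"
    by (rule joint_regroup_carrier)
  have PtP: "transpose_mat ?P * ?P = 1\<^sub>m ?n"
    unfolding joint_regroup_def by (rule regroup_mat_orthogonal) simp
  have B: "?B \<in> carrier_mat ?n (dim_io S1 + dim_io S2)"
    by (rule joint_B_carrier[OF S1 S2])
  have J: "?J \<in> carrier_mat ?n ?n" and R: "?R \<in> carrier_mat ?n ?n"
    using carr by blast+
  have J0: "?J + ?B * K * transpose_mat ?B \<in> carrier_mat ?n ?n"
    and R0: "?R + ?B * L * transpose_mat ?B \<in> carrier_mat ?n ?n"
    using J R B K L by simp_all
  have f12: "f1 @\<^sub>v f2 \<in> carrier_vec ?n" and g12: "g1 @\<^sub>v g2 \<in> carrier_vec ?n"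
    and v12: "v1 @\<^sub>v v2 \<in> carrier_vec (dim_io S1 + dim_io S2)"
    using f g v by auto
  have Btf: "transpose_mat ?B *\<^sub>v (f1 @\<^sub>v f2) = transpose_mat (mat_B S1) *\<^sub>v f1 @\<^sub>v transpose_mat (mat_B S2) *\<^sub>v f2"
    unfolding joint_B_def block_diag_transpose
    using carr f by (intro block_diag_mult_append) auto
  have rhs: "(?J - ?R) *\<^sub>v (f1 @\<^sub>v f2) + ?B *\<^sub>v (u1 @\<^sub>v u2) =
    ((mat_J S1 - mat_R S1) *\<^sub>v f1 + mat_B S1 *\<^sub>v u1) @\<^sub>v
    ((mat_J S2 - mat_R S2) *\<^sub>v f2 + mat_B S2 *\<^sub>v u2)"
  proof -
    have "(?J - ?R) *\<^sub>v (f1 @\<^sub>v f2) = (mat_J S1 - mat_R S1) *\<^sub>v f1 @\<^sub>v (mat_J S2 - mat_R S2) *\<^sub>v f2"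
      using carr f
      by (subst block_diag_minus[OF carr(2,3,7,8)]) (intro block_diag_mult_append minus_carrier_mat; assumption)
    moreover have "?B *\<^sub>v (u1 @\<^sub>v u2) = mat_B S1 *\<^sub>v u1 @\<^sub>v mat_B S2 *\<^sub>v u2"
      unfolding joint_B_def using carr u by (intro block_diag_mult_append)
    moreover have "mat_B S1 *\<^sub>v u1 \<in> carrier_vec (dim_total S1)" "mat_B S2 *\<^sub>v u2 \<in> carrier_vec (dim_total S2)"
      "(mat_J S1 - mat_R S1) *\<^sub>v f1 \<in> carrier_vec (dim_total S1)"
      "(mat_J S2 - mat_R S2) *\<^sub>v f2 \<in> carrier_vec (dim_total S2)"
      using carr u f by (metis mult_mat_vec_carrier minus_carrier_mat)+
    ultimately show ?thesis
      by (metis append_vec_add)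
  qed
  have "eb_equations ?S (stack z1 z2) (stack dz1 dz2) (v1 @\<^sub>v v2) (y1 @\<^sub>v y2) \<longleftrightarrow>
    ?P *\<^sub>v (g1 @\<^sub>v g2) = (mat_J ?S - mat_R ?S) *\<^sub>v (?P *\<^sub>v (f1 @\<^sub>v f2)) + mat_B ?S *\<^sub>v (v1 @\<^sub>v v2) \<and>
    y1 @\<^sub>v y2 = transpose_mat (mat_B ?S) *\<^sub>v (?P *\<^sub>v (f1 @\<^sub>v f2))"
    unfolding z1(1) z2(1) dz1(1) dz2(1) stack.simps eb_equations.simps f_S g_S ..
  also have "\<dots> \<longleftrightarrow>
    g1 @\<^sub>v g2 = (?J + ?B * K * transpose_mat ?B - (?R + ?B * L * transpose_mat ?B)) *\<^sub>v (f1 @\<^sub>v f2) +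
      ?B *\<^sub>v (v1 @\<^sub>v v2) \<and>
    y1 @\<^sub>v y2 = transpose_mat ?B *\<^sub>v (f1 @\<^sub>v f2)"
    using orthogonal_transform_equation[OF P PtP J0 R0 B f12 g12 v12]
    by (simp add: interconnection_def del: assoc_mult_mat)
  \<comment> \<open>The output equation is kept as a conjunct because it replaces
    \<open>B^T f\<close> by the stacked output, after which the interconnection law supplies
    \<open>u1\<close> and \<open>u2\<close>.\<close>
  also have "\<dots> \<longleftrightarrow> g1 @\<^sub>v g2 = (?J - ?R) *\<^sub>v (f1 @\<^sub>v f2) + ?B *\<^sub>v (u1 @\<^sub>v u2) \<and>
    y1 @\<^sub>v y2 = transpose_mat ?B *\<^sub>v (f1 @\<^sub>v f2)"
    unfolding output_feedback[OF J R B K L f12 v12] inter[unfolded interconnected_def] by auto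
  also have "\<dots> \<longleftrightarrow> eb_equations S1 z1 dz1 u1 y1 \<and> eb_equations S2 z2 dz2 u2 y2"
  proof -
    \<comment> \<open>Equality of concatenations splits once the first parts are known to have equal
      length.\<close>
    have rhs1: "(mat_J S1 - mat_R S1) *\<^sub>v f1 + mat_B S1 *\<^sub>v u1 \<in> carrier_vec (dim_total S1)"
      using carr u f by (metis add_carrier_vec mult_mat_vec_carrier minus_carrier_mat)
    have out1: "transpose_mat (mat_B S1) *\<^sub>v f1 \<in> carrier_vec (dim_io S1)"
      using carr f by (metis mult_mat_vec_carrier transpose_carrier_mat)
    show ?thesis
      unfolding z1(1) z2(1) dz1(1) dz2(1) eb_equations.simps rhs Btf
        f1_def[symmetric] f2_def[symmetric] g1_def[symmetric] g2_def[symmetric]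
        append_vec_eq[OF g(1) rhs1] append_vec_eq[OF y(1) out1]
      by blast
  qed
  finally show ?thesis ..
qed

section \<open>From the equations at one instant to solutions on a time interval\<close>

lemma stack_components:
  "fst (stack p q) = fst p @\<^sub>v fst q"
  "fst (snd (stack p q)) = fst (snd p) @\<^sub>v fst (snd q)"
  "snd (snd (stack p q)) = snd (snd p) @\<^sub>v snd (snd q)"
  by (cases p rule: prod_cases3; cases q rule: prod_cases3; simp)+

text \<open>Regularity splits along concatenations, and the derivative of the stacked curve is the
  stack of the derivatives, so the equivalence at each instant applies.\<close>

lemma eb_solution_interconnection:
  assumes S1: "energy_based_form S1" and S2: "energy_based_form S2"
    and K: "K \<in> carrier_mat (dim_io S1 + dim_io S2) (dim_io S1 + dim_io S2)"
    and L: "L \<in> carrier_mat (dim_io S1 + dim_io S2) (dim_io S1 + dim_io S2)"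
    and z: "z1 \<in> T \<rightarrow> states S1" "z2 \<in> T \<rightarrow> states S2"
    and u: "u1 \<in> T \<rightarrow> carrier_vec (dim_io S1)" "u2 \<in> T \<rightarrow> carrier_vec (dim_io S2)"
    and v: "v1 \<in> T \<rightarrow> carrier_vec (dim_io S1)" "v2 \<in> T \<rightarrow> carrier_vec (dim_io S2)"
    and y: "y1 \<in> T \<rightarrow> carrier_vec (dim_io S1)" "y2 \<in> T \<rightarrow> carrier_vec (dim_io S2)"
    and inter: "\<forall>t\<in>T. interconnected (K - L) (u1 t) (u2 t) (y1 t) (y2 t) (v1 t) (v2 t)"
  shows "eb_solution S1 T z1 u1 y1 \<and> eb_solution S2 T z2 u2 y2 \<longleftrightarrow>
    eb_solution (interconnection S1 S2 K L) T (\<lambda>t. stack (z1 t) (z2 t))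
      (\<lambda>t. v1 t @\<^sub>v v2 t) (\<lambda>t. y1 t @\<^sub>v y2 t)"
proof -
  have c1: "(\<lambda>s. fst (z1 s)) \<in> T \<rightarrow> carrier_vec (dim_z1 S1)"
    "(\<lambda>s. fst (snd (z1 s))) \<in> T \<rightarrow> carrier_vec (dim_z2 S1)"
    "(\<lambda>s. snd (snd (z1 s))) \<in> T \<rightarrow> carrier_vec (dim_z3 S1)"
    using z(1) by (fastforce simp: states_def Pi_iff)+
  have c2: "(\<lambda>s. fst (z2 s)) \<in> T \<rightarrow> carrier_vec (dim_z1 S2)"
    "(\<lambda>s. fst (snd (z2 s))) \<in> T \<rightarrow> carrier_vec (dim_z2 S2)"
    "(\<lambda>s. snd (snd (z2 s))) \<in> T \<rightarrow> carrier_vec (dim_z3 S2)"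
    using z(2) by (fastforce simp: states_def Pi_iff)+
  \<comment> \<open>This holds for arbitrary curves and times, since \<open>curve_deriv\<close> has
    the prescribed length by construction.\<close>
  have deriv_states: "state_deriv S T z t \<in> states S" for S z t
    by (simp add: state_deriv_def states_def curve_deriv_def)
  have deriv: "state_deriv (interconnection S1 S2 K L) T (\<lambda>t. stack (z1 t) (z2 t)) t =
    stack (state_deriv S1 T z1 t) (state_deriv S2 T z2 t)" if "t \<in> T" for t
    using curve_deriv_append[OF c1(1) c2(1) that] curve_deriv_append[OF c1(2) c2(2) that]
      curve_deriv_append[OF c1(3) c2(3) that]
    by (simp add: state_deriv_def stack_components)
  have eqs: "eb_equations S1 (z1 t) (state_deriv S1 T z1 t) (u1 t) (y1 t) \<and>
      eb_equations S2 (z2 t) (state_deriv S2 T z2 t) (u2 t) (y2 t) \<longleftrightarrow>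
    eb_equations (interconnection S1 S2 K L) (stack (z1 t) (z2 t))
      (state_deriv (interconnection S1 S2 K L) T (\<lambda>t. stack (z1 t) (z2 t)) t)
      (v1 t @\<^sub>v v2 t) (y1 t @\<^sub>v y2 t)" if t: "t \<in> T" for t
    unfolding deriv[OF t] using t z u v y inter
    by (intro eb_equations_interconnection[OF S1 S2 K L] deriv_states) auto
  have v12: "(\<lambda>t. v1 t @\<^sub>v v2 t) \<in> T \<rightarrow> carrier_vec (dim_io S1 + dim_io S2)"
    using v by (auto simp: Pi_iff)
  show ?thesis
    unfolding eb_solution_def interconnection_simps stack_components
      C1_curve_append[OF c1(1) c2(1)] C1_curve_append[OF c1(2) c2(2)] C1_curve_append[OF c1(3) c2(3)]
      C0_curve_append[OF y]
    using u v12 eqs by blast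
qed

text \<open>The law is explicit in the inputs: its right-hand side only has to be cut into two
  parts. This supplies the witnesses when inputs must be recovered from the combined system.\<close>

lemma interconnected_input_exists:
  assumes "F \<in> carrier_mat (k + m) (k + m)" "y1 \<in> carrier_vec k" "y2 \<in> carrier_vec m"
    "v1 \<in> carrier_vec k" "v2 \<in> carrier_vec m"
  shows "\<exists>u1\<in>carrier_vec k. \<exists>u2\<in>carrier_vec m. interconnected F u1 u2 y1 y2 v1 v2"
proof -
  let ?u = "F *\<^sub>v (y1 @\<^sub>v y2) + (v1 @\<^sub>v v2)"
  have "?u \<in> carrier_vec (k + m)"
    using assms by auto
  then have "interconnected F (vec_first ?u k) (vec_last ?u m) y1 y2 v1 v2"
    by (simp add: interconnected_def)
  then show ?thesis
    by (meson vec_first_carrier vec_last_carrier)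
qed

theorem theorem4:
  fixes S1 S2 :: eb_system and F_skew F_sym :: "real mat"
  assumes "energy_based_form S1" and "energy_based_form S2"
    and "F_skew \<in> carrier_mat (dim_io S1 + dim_io S2) (dim_io S1 + dim_io S2)"
    and "F_sym \<in> carrier_mat (dim_io S1 + dim_io S2) (dim_io S1 + dim_io S2)"
    and "F_skew = - transpose_mat F_skew"
    and "F_sym = transpose_mat F_sym"
    and "pos_semidef (dim_io S1 + dim_io S2) F_sym"
  shows "\<exists>S. energy_based_form S \<and>
    dim_z1 S = dim_z1 S1 + dim_z1 S2 \<and>
    dim_z2 S = dim_z2 S1 + dim_z2 S2 \<and>
    dim_z3 S = dim_z3 S1 + dim_z3 S2 \<and>
    dim_io S = dim_io S1 + dim_io S2 \<and>
    (\<forall>z1\<in>states S1. \<forall>z2\<in>states S2. \<forall>dz1\<in>states S1. \<forall>dz2\<in>states S2.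
     \<forall>v1\<in>carrier_vec (dim_io S1). \<forall>v2\<in>carrier_vec (dim_io S2).
     \<forall>y1\<in>carrier_vec (dim_io S1). \<forall>y2\<in>carrier_vec (dim_io S2).
       (\<exists>u1\<in>carrier_vec (dim_io S1). \<exists>u2\<in>carrier_vec (dim_io S2).
          eb_equations S1 z1 dz1 u1 y1 \<and> eb_equations S2 z2 dz2 u2 y2 \<and>
          interconnected (F_skew - F_sym) u1 u2 y1 y2 v1 v2)
       \<longleftrightarrow> eb_equations S (stack z1 z2) (stack dz1 dz2) (v1 @\<^sub>v v2) (y1 @\<^sub>v y2)) \<and>
    (\<forall>(t0::real) tf z1 z2 v1 v2 y1 y2. t0 < tf \<longrightarrow>
       z1 \<in> {t0..tf} \<rightarrow> states S1 \<longrightarrow> z2 \<in> {t0..tf} \<rightarrow> states S2 \<longrightarrow>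
       v1 \<in> {t0..tf} \<rightarrow> carrier_vec (dim_io S1) \<longrightarrow> v2 \<in> {t0..tf} \<rightarrow> carrier_vec (dim_io S2) \<longrightarrow>
       y1 \<in> {t0..tf} \<rightarrow> carrier_vec (dim_io S1) \<longrightarrow> y2 \<in> {t0..tf} \<rightarrow> carrier_vec (dim_io S2) \<longrightarrow>
       (\<exists>u1 u2. eb_solution S1 {t0..tf} z1 u1 y1 \<and> eb_solution S2 {t0..tf} z2 u2 y2 \<and>
          (\<forall>t\<in>{t0..tf}. interconnected (F_skew - F_sym) (u1 t) (u2 t) (y1 t) (y2 t) (v1 t) (v2 t)))
       \<longleftrightarrow> eb_solution S {t0..tf} (\<lambda>t. stack (z1 t) (z2 t))
             (\<lambda>t. v1 t @\<^sub>v v2 t) (\<lambda>t. y1 t @\<^sub>v y2 t))"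
proof -
  let ?S = "interconnection S1 S2 F_skew F_sym" and ?F = "F_skew - F_sym"
  have F: "?F \<in> carrier_mat (dim_io S1 + dim_io S2) (dim_io S1 + dim_io S2)"
    by (rule minus_carrier_mat) fact
  have pointwise: "(\<exists>u1\<in>carrier_vec (dim_io S1). \<exists>u2\<in>carrier_vec (dim_io S2).
      eb_equations S1 z1 dz1 u1 y1 \<and> eb_equations S2 z2 dz2 u2 y2 \<and>
      interconnected ?F u1 u2 y1 y2 v1 v2)
    \<longleftrightarrow> eb_equations ?S (stack z1 z2) (stack dz1 dz2) (v1 @\<^sub>v v2) (y1 @\<^sub>v y2)"
    if "z1 \<in> states S1" "z2 \<in> states S2" "dz1 \<in> states S1" "dz2 \<in> states S2"
      and v: "v1 \<in> carrier_vec (dim_io S1)" "v2 \<in> carrier_vec (dim_io S2)"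
      and y: "y1 \<in> carrier_vec (dim_io S1)" "y2 \<in> carrier_vec (dim_io S2)"
    for z1 z2 dz1 dz2 v1 v2 y1 y2
    using interconnected_input_exists[OF F y v]
      eb_equations_interconnection[OF assms(1-4) that(1-4) _ _ v y] by metis
  have solutions: "(\<exists>u1 u2. eb_solution S1 T z1 u1 y1 \<and> eb_solution S2 T z2 u2 y2 \<and>
      (\<forall>t\<in>T. interconnected ?F (u1 t) (u2 t) (y1 t) (y2 t) (v1 t) (v2 t)))
    \<longleftrightarrow> eb_solution ?S T (\<lambda>t. stack (z1 t) (z2 t)) (\<lambda>t. v1 t @\<^sub>v v2 t) (\<lambda>t. y1 t @\<^sub>v y2 t)"
    (is "?l \<longleftrightarrow> ?r")
    if z: "z1 \<in> T \<rightarrow> states S1" "z2 \<in> T \<rightarrow> states S2"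
      and v: "v1 \<in> T \<rightarrow> carrier_vec (dim_io S1)" "v2 \<in> T \<rightarrow> carrier_vec (dim_io S2)"
      and y: "y1 \<in> T \<rightarrow> carrier_vec (dim_io S1)" "y2 \<in> T \<rightarrow> carrier_vec (dim_io S2)"
    for T z1 z2 v1 v2 y1 y2
  proof
    assume ?l
    then show ?r
      using eb_solution_interconnection[OF assms(1-4) z _ _ v y] by (metis eb_solution_def)
  next
    assume r: ?r
    \<comment> \<open>The inputs are chosen separately at each time. A solution requires only that
      they have the right length, so no regularity of the choice has to be shown.\<close>
    have "\<forall>t\<in>T. \<exists>u1 u2. u1 \<in> carrier_vec (dim_io S1) \<and> u2 \<in> carrier_vec (dim_io S2) \<and>
      interconnected ?F u1 u2 (y1 t) (y2 t) (v1 t) (v2 t)"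
      using interconnected_input_exists[OF F] v y by (metis Pi_mem)
    then obtain u1 u2 where "\<forall>t\<in>T. u1 t \<in> carrier_vec (dim_io S1) \<and> u2 t \<in> carrier_vec (dim_io S2) \<and>
      interconnected ?F (u1 t) (u2 t) (y1 t) (y2 t) (v1 t) (v2 t)"
      by metis
    then have "u1 \<in> T \<rightarrow> carrier_vec (dim_io S1)" "u2 \<in> T \<rightarrow> carrier_vec (dim_io S2)"
      and inter: "\<forall>t\<in>T. interconnected ?F (u1 t) (u2 t) (y1 t) (y2 t) (v1 t) (v2 t)"
      by auto
    from eb_solution_interconnection[OF assms(1-4) z this(1,2) v y inter] r inter show ?l
      by blast
  qed
  have "energy_based_form ?S"
    by (rule energy_based_form_interconnection) fact+
  then show ?thesis
    using pointwise solutions by (intro exI[of _ ?S] conjI ballI allI impI interconnection_simps) blast+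
qed

end
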